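(* Let $K,L\in\mathcal{K}^n_0$, let $p,q\in[-\infty,\infty]$, and let $M_p\in\{\overline{M}_p,\underline{M}_p\}$, $M_q\in\{\overline{M}_q,\underline{M}_q\}$. Then \[ \frac{m_p(R_0^{\max}(K,L),1)}{m_q(R_0^{\max}(K,L),1)}\le R_0(M_p(K,L),M_q(K,L)). \] Equality is attained whenever $n=1$ or $K$ and $L$ are dilates of each other.
   Context: $\mathcal{K}^n_0$ denotes the set of compact convex subsets of $\mathbb{R}^n$ containing the origin in their interior. For $C\in\mathcal{K}^n_0$, $h_C(a)=\sup\{a^Tx : x\in C\}$ is the support function and $\|x\|_C=\inf\{\lambda\ge 0 : x\in\lambda C\}$ the gauge function. For $x,y>0$, $m_p(x,y)=\left(\frac{x^p+y^p}{2}\right)^{1/p}$ if $p\in\mathbb{R}\setminus\{0\}$, $m_0(x,y)=\sqrt{xy}$, $m_{-\infty}(x,y)=\min\{x,y\}$, $m_\infty(x,y)=\max\{x,y\}$. $\mathbb{S}_2$ is the Euclidean unit sphere in $\mathbb{R}^n$. For $K,L\in\mathcal{K}^n_0$ and $p\in[-\infty,\infty]$, the upper $p$-mean is \[ \overline{M}_p(K,L)=\{x\in\mathbb{R}^n : a^Tx\le m_p(h_K(a),h_L(a)) \text{ for all } a\in\mathbb{S}_2\}, \] and the lower $p$-mean is \[ \underline{M}_p(K,L)=\mathrm{conv}\left(\left\{m_p(\|v\|_K^{-1},\|v\|_L^{-1})\,v : v\in\mathbb{S}_2\right\}\right), \] where $\mathrm{conv}$ denotes the convex hull. The covering radius of $K$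 with respect to $L$ is $R_0(K,L)=\inf\{\lambda\ge0 : K\subset\lambda L\}$, and the covering distance is $R_0^{\max}(K,L)=\max\{R_0(K,L),R_0(L,K)\}$. $K$ and $L$ are dilates of each other if $L=\lambda K$ for some $\lambda>0$.
   Formalization: The equality claim for n=1 is proved only for q ≤ p; for p < q it is false, e.g. K=[-1,2], L=[-1,1], p=-∞, q=∞ gives 1/2 < 1. The inequality and the equality for dilates are unrestricted. *)

theory Defs
  imports "HOL-Analysis.Analysis"
begin

definition convex_bodies0 :: "(real ^ 'n) set set" where
  "convex_bodies0 = {C. compact C \<and> convex C \<and> 0 \<in> interior C}"

definition support_fun :: "(real ^ 'n) set \<Rightarrow> real ^ 'n \<Rightarrow> real" where
  "support_fun C a = (SUP x\<in>C. a \<bullet> x)"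

definition gauge_fun :: "(real ^ 'n) set \<Rightarrow> real ^ 'n \<Rightarrow> real" where
  "gauge_fun C x = Inf {l. l \<ge> 0 \<and> x \<in> (*\<^sub>R) l ` C}"

text \<open>Only meant for positive real arguments, where \<open>powr\<close> is the usual real power.\<close>

definition pmean :: "ereal \<Rightarrow> real \<Rightarrow> real \<Rightarrow> real" where
  "pmean p x y = (case p of
      ereal r \<Rightarrow> (if r = 0 then sqrt (x * y)
                  else ((x powr r + y powr r) / 2) powr (1 / r))
    | PInfty \<Rightarrow> max x y
    | MInfty \<Rightarrow> min x y)"

definition upper_pmean :: "ereal \<Rightarrow> (real ^ 'n) set \<Rightarrow> (real ^ 'n) set \<Rightarrow> (real ^ 'n) set" where
  "upper_pmean p K L =
    {x. \<forall>a\<in>sphere 0 1. a \<bullet> x \<le> pmean p (support_fun K a) (support_fun L a)}"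

definition lower_pmean :: "ereal \<Rightarrow> (real ^ 'n) set \<Rightarrow> (real ^ 'n) set \<Rightarrow> (real ^ 'n) set" where
  "lower_pmean p K L = convex hull
    ((\<lambda>v. pmean p (inverse (gauge_fun K v)) (inverse (gauge_fun L v)) *\<^sub>R v) ` sphere 0 1)"

definition covering_radius :: "(real ^ 'n) set \<Rightarrow> (real ^ 'n) set \<Rightarrow> real" where
  "covering_radius K L = Inf {l. l \<ge> 0 \<and> K \<subseteq> (*\<^sub>R) l ` L}"

definition covering_dist :: "(real ^ 'n) set \<Rightarrow> (real ^ 'n) set \<Rightarrow> real" where
  "covering_dist K L = max (covering_radius K L) (covering_radius L K)"

definition dilates :: "(real ^ 'n) set \<Rightarrow> (real ^ 'n) set \<Rightarrow> bool" where
  "dilates K L \<longleftrightarrow> (\<exists>c>0. L = (*\<^sub>R) c ` K)"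

text \<open>In dimension one, equality between \<open>m\<^sub>p(R,1) / m\<^sub>q(R,1)\<close>, where \<open>R\<close> is the covering
  distance, and the covering radius of the means can fail if \<open>p < q\<close>. For \<open>K = [-1,2]\<close>,
  \<open>L = [-1,1]\<close>, \<open>p = -\<infinity>\<close> and \<open>q = \<infinity>\<close> the two sides are \<open>1/2\<close> and \<open>1\<close>.\<close>

lemma dim_one_equality_fails:
  "\<exists>K\<in>convex_bodies0. \<exists>L\<in>convex_bodies0.
     pmean (-\<infinity>) (covering_dist K (L :: (real ^ 1) set)) 1 / pmean \<infinity> (covering_dist K L) 1
       < covering_radius (upper_pmean (-\<infinity>) K L) (upper_pmean \<infinity> K L)"
proof -
  define K :: "(real ^ 1) set" where "K = cbox (vec (-1)) (vec 2)"
  define L :: "(real ^ 1) set" where "L = cbox (vec (-1)) (vec 1)"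
  have memK: "x \<in> K \<longleftrightarrow> -1 \<le> x $ 1 \<and> x $ 1 \<le> 2" for x
    by (simp add: K_def mem_box_cart)
  have memL: "x \<in> L \<longleftrightarrow> -1 \<le> x $ 1 \<and> x $ 1 \<le> 1" for x
    by (simp add: L_def mem_box_cart)
  have inner1: "a \<bullet> x = a $ 1 * x $ 1" for a x :: "real ^ 1"
    by (simp add: inner_vec_def)
  have bodies: "K \<in> convex_bodies0" "L \<in> convex_bodies0"
    by (auto simp: convex_bodies0_def K_def L_def interior_cbox mem_box_cart)
  let ?S = "\<lambda>a. support_fun K a" and ?T = "\<lambda>a. support_fun L a"
  have sup_ge: "a \<bullet> x \<le> support_fun C a" if "C \<in> convex_bodies0" "x \<in> C" for C a and x :: "real ^ 1"
  proof -
    have "compact ((\<bullet>) a ` C)"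
      using that by (intro compact_continuous_image continuous_intros) (auto simp: convex_bodies0_def)
    then have "bdd_above ((\<bullet>) a ` C)"
      by (simp add: bounded_imp_bdd_above compact_imp_bounded)
    then show ?thesis unfolding support_fun_def using that(2) by (rule cSUP_upper2) auto
  qed
  have mneg: "pmean (-\<infinity>) x y = min x y" and mpos: "pmean \<infinity> x y = max x y" for x y
    by (simp_all add: pmean_def flip: MInfty_eq_minfinity PInfty_eq_infinity)
  have sphere: "(vec (-1) :: real ^ 1) \<in> sphere 0 1"
    by (simp add: norm_eq_1 inner1)
  have "?S (vec (-1)) \<le> 1" "?T (vec (-1)) \<le> 1"
    unfolding support_fun_def
    by (rule cSUP_least; use bodies in \<open>auto simp: memK memL inner1 convex_bodies0_def interior_def\<close>)+
  then have upper: "- x $ 1 \<le> 1" if "x \<in> upper_pmean \<infinity> K L" for x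
    using that sphere by (force simp: upper_pmean_def mpos inner1)
  have lower: "(vec (-1) :: real ^ 1) \<in> upper_pmean (-\<infinity>) K L"
    using sup_ge[OF bodies(1), of "vec (-1)"] sup_ge[OF bodies(2), of "vec (-1)"]
    by (auto simp: upper_pmean_def mneg memK memL)
  have sub: "upper_pmean (-\<infinity>) K L \<subseteq> upper_pmean \<infinity> K L"
    by (fastforce simp: upper_pmean_def mneg mpos)
  have "1 \<le> covering_radius (upper_pmean (-\<infinity>) K L) (upper_pmean \<infinity> K L)"
    unfolding covering_radius_def
  proof (rule cInf_greatest)
    show "{l. l \<ge> 0 \<and> upper_pmean (-\<infinity>) K L \<subseteq> (*\<^sub>R) l ` upper_pmean \<infinity> K L} \<noteq> {}"
      using sub by (auto intro!: exI[of _ 1])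
  next
    fix l assume "l \<in> {l. l \<ge> 0 \<and> upper_pmean (-\<infinity>) K L \<subseteq> (*\<^sub>R) l ` upper_pmean \<infinity> K L}"
    then have "l \<ge> 0" and "vec (-1) \<in> (*\<^sub>R) l ` upper_pmean \<infinity> K L"
      using lower by blast+
    then obtain y where y: "y \<in> upper_pmean \<infinity> K L" "vec (-1) = l *\<^sub>R y"
      by blast
    have "-1 = l * y $ 1"
      using arg_cong[OF y(2), of "\<lambda>v. v $ 1"] by simp
    moreover have "l * (- y $ 1) \<le> l * 1"
      using upper[OF y(1)] \<open>l \<ge> 0\<close> by (rule mult_left_mono)
    ultimately show "1 \<le> l" by simp
  qed
  moreover have "2 \<le> covering_radius K L"
    unfolding covering_radius_def
  proof (rule cInf_greatest)
    have "x \<in> (*\<^sub>R) 2 ` L" if "x \<in> K" for x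
      using that by (intro image_eqI[of _ _ "(1/2) *\<^sub>R x"]) (auto simp: memK memL)
    then show "{l. l \<ge> 0 \<and> K \<subseteq> (*\<^sub>R) l ` L} \<noteq> {}"
      by (auto intro!: exI[of _ 2])
  next
    fix l assume "l \<in> {l. l \<ge> 0 \<and> K \<subseteq> (*\<^sub>R) l ` L}"
    moreover have "vec 2 \<in> K" by (simp add: memK)
    ultimately have "l \<ge> 0" "vec 2 \<in> (*\<^sub>R) l ` L" by blast+
    then obtain y where y: "y \<in> L" "vec 2 = l *\<^sub>R y"
      by blast
    have "2 = l * y $ 1"
      using arg_cong[OF y(2), of "\<lambda>v. v $ 1"] by simp
    moreover have "l * y $ 1 \<le> l * 1"
      using y(1) \<open>l \<ge> 0\<close> by (intro mult_left_mono) (auto simp: memL)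
    ultimately show "2 \<le> l" by simp
  qed
  then have "covering_dist K L \<ge> 2" by (simp add: covering_dist_def)
  then have "pmean (-\<infinity>) (covering_dist K L) 1 / pmean \<infinity> (covering_dist K L) 1 < 1"
    by (simp add: mneg mpos)
  ultimately show ?thesis using bodies by force
qed

end

theory Submission
  imports Defs
begin

text \<open>
  Write \<open>R\<close> for the covering distance and \<open>m\<^sub>p\<close> for the \<open>p\<close>-mean of numbers. Everything rests on
  the elementary inclusion of the lower \<open>p\<close>-mean in the upper one, for the same \<open>p\<close>
  (\<open>lower_pmean_subset_upper_pmean\<close>): whatever the choice of the two means, the first lies
  between the lower and the upper \<open>p\<close>-mean, and the second between the lower and the upper
  \<open>q\<close>-mean.

  For the inequality, both means are symmetric in \<open>K\<close> and \<open>L\<close>, so \<open>R\<close> may be taken to be the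
  covering radius of \<open>K\<close> with respect to \<open>L\<close>. Then \<open>K\<close> touches the boundary of \<open>R L\<close> in a point
  \<open>x\<close> with a common outer normal \<open>a\<close>, hence \<open>h\<^sub>K(a) = R h\<^sub>L(a)\<close> (\<open>covering_radius_touching\<close>).
  The lower \<open>p\<close>-mean reaches height \<open>m\<^sub>p(R,1) h\<^sub>L(a)\<close> in direction \<open>a\<close>, on the ray through \<open>x\<close>,
  whereas the upper \<open>q\<close>-mean stays at or below \<open>m\<^sub>q(R,1) h\<^sub>L(a)\<close>. A factor that scales the second
  mean over the first is therefore at least the quotient of these heights
  (\<open>pmean_quotient_le_of_lower_subset_scaled_upper\<close>).

  For equality it is enough to put the upper \<open>p\<close>-mean inside the lower \<open>q\<close>-mean scaled by
  \<open>m\<^sub>p(R,1) / m\<^sub>q(R,1)\<close>, and this can be tested ray by ray (\<open>subset_scaled_lower_pmean\<close>). For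
  dilates the means are all multiples of \<open>K\<close>. On the line the two ends of the segments are
  independent of each other, and the test at one end, where the support values have ratio
  \<open>t \<in> [1, R]\<close> in one order or the other, says that \<open>m\<^sub>p(t,1) / m\<^sub>q(t,1)\<close> is at most its value
  at \<open>R\<close>. It is, because for \<open>q \<le> p\<close> this quotient is nondecreasing in \<open>t \<ge> 1\<close>
  (\<open>pmean_quotient_mono\<close>).
\<close>

section \<open>Power means of two positive numbers\<close>

lemma pmean_simps:
  "pmean (ereal r) x y =
     (if r = 0 then sqrt (x * y) else ((x powr r + y powr r) / 2) powr (1 / r))"
  "pmean \<infinity> x y = max x y"
  "pmean (-\<infinity>) x y = min x y"
  by (simp_all add: pmean_def flip: MInfty_eq_minfinity PInfty_eq_infinity)

lemma pmean_commute: "pmean p x y = pmean p y x"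
  by (cases p) (auto simp: pmean_simps ac_simps)

lemma pmean_pos:
  assumes "x > 0" "y > 0"
  shows "pmean p x y > 0"
proof -
  have "x powr r + y powr r \<noteq> 0" for r
    using assms by (metis add_pos_pos less_irrefl powr_gt_zero)
  then show ?thesis
    using assms by (cases p) (auto simp: pmean_simps)
qed

lemma pmean_mult:
  assumes "c > 0" "x > 0" "y > 0"
  shows "pmean p (c * x) (c * y) = c * pmean p x y"
proof (cases p)
  case (real r)
  show ?thesis
  proof (cases "r = 0")
    case True
    then show ?thesis
      using assms by (simp add: real pmean_simps real_sqrt_mult)
  next
    case False
    define A where "A = (x powr r + y powr r) / 2"
    have "A \<ge> 0"
      by (simp add: A_def)
    have "((c * x) powr r + (c * y) powr r) / 2 = c powr r * A"
      using assms by (simp add: A_def powr_mult algebra_simps add_divide_distrib)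
    then have "pmean p (c * x) (c * y) = (c powr r * A) powr (1 / r)"
      using False by (simp add: real pmean_simps)
    also have "\<dots> = c * A powr (1 / r)"
      using assms False \<open>A \<ge> 0\<close> by (simp add: powr_mult powr_powr)
    also have "A powr (1 / r) = pmean p x y"
      using False by (simp add: real pmean_simps A_def)
    finally show ?thesis .
  qed
qed (use assms in \<open>auto simp: pmean_simps max_mult_distrib_left min_mult_distrib_left\<close>)

lemma pmean_mono:
  assumes "x > 0" "y > 0" "x \<le> x'" "y \<le> y'"
  shows "pmean p x y \<le> pmean p x' y'"
proof (cases p)
  case (real r)
  consider "r = 0" | "r > 0" | "r < 0" by linarith
  then show ?thesis
  proof cases
    case 1
    then show ?thesis
      using assms by (simp add: real pmean_simps mult_mono)
  next
    case 2
    have "x powr r + y powr r \<le> x' powr r + y' powr r"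
      using assms 2 by (intro add_mono powr_mono2) auto
    then show ?thesis
      using 2 by (auto simp: real pmean_simps intro!: powr_mono2 add_nonneg_nonneg)
  next
    case 3
    have "x' powr r + y' powr r \<le> x powr r + y powr r"
      using assms 3 by (intro add_mono powr_mono2') auto
    moreover have "x' powr r + y' powr r > 0"
      using assms by (intro add_pos_pos) auto
    ultimately show ?thesis
      using 3 by (auto simp: real pmean_simps intro!: powr_mono2')
  qed
qed (use assms in \<open>auto simp: pmean_simps\<close>)

text \<open>This is \<open>t (d/dt) ln (pmean p t 1)\<close>, for \<open>t > 1\<close>: the logistic function at \<open>p ln t\<close>.
  Written like this, the geometric mean needs no separate case, and monotonicity in \<open>p\<close> is
  evident.\<close>

definition log_slope :: "ereal \<Rightarrow> real \<Rightarrow> real" where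
  "log_slope p t = (case p of
      ereal r \<Rightarrow> 1 / (1 + t powr - r)
    | PInfty \<Rightarrow> 1
    | MInfty \<Rightarrow> 0)"

lemma log_slope_simps:
  "log_slope (ereal r) t = 1 / (1 + t powr - r)"
  "log_slope \<infinity> t = 1"
  "log_slope (-\<infinity>) t = 0"
  by (simp_all add: log_slope_def flip: MInfty_eq_minfinity PInfty_eq_infinity)

lemma log_slope_mono:
  assumes "q \<le> p" "t \<ge> 1"
  shows "log_slope q t \<le> log_slope p t"
proof -
  have pos: "1 + t powr u > 0" for u
    by (meson add_pos_nonneg powr_ge_zero zero_less_one)
  have le1: "1 / (1 + t powr u) \<le> 1" for u
    using pos[of u] by (simp add: divide_le_eq)
  have ge0: "0 \<le> 1 / (1 + t powr u)" for u
    using pos[of u] by simp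
  have "1 / (1 + t powr - r) \<le> 1 / (1 + t powr - s)" if "r \<le> s" for r s
    using that assms(2) pos[of "-s"] by (intro divide_left_mono powr_mono add_mono mult_pos_pos pos) auto
  then show ?thesis
    using assms(1) le1 ge0
    by (cases q; cases p) (auto simp: log_slope_simps)
qed

text \<open>At \<open>t = 1\<close> the maximum and the minimum have one-sided derivatives only, hence the
  restriction to \<open>{1..}\<close>.\<close>

lemma ln_pmean_has_derivative:
  assumes "t \<ge> 1"
  shows "((\<lambda>t. ln (pmean p t 1)) has_real_derivative log_slope p t / t) (at t within {1..})"
proof (cases p)
  case (real r)
  have "((\<lambda>t. ln (pmean p t 1)) has_real_derivative log_slope p t / t) (at t)"
  proof (cases "r = 0")
    case True
    have "((\<lambda>t. ln (sqrt t)) has_real_derivative log_slope p t / t) (at t)"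
      using assms by (auto intro!: derivative_eq_intros simp: real True log_slope_simps field_simps)
    then show ?thesis
      by (simp add: real True pmean_simps)
  next
    case False
    have pos: "s powr r + 1 > 0" for s
      by (meson add_nonneg_pos powr_ge_zero zero_less_one)
    have "t powr r > 0" "t > 0" using assms by auto
    have "t powr (r - 1) / (t powr r + 1) = (t powr r / (t powr r + 1)) / t"
      using \<open>t > 0\<close> by (simp add: powr_diff)
    also have "t powr r / (t powr r + 1) = log_slope p t"
      using \<open>t > 0\<close> \<open>t powr r > 0\<close> pos[of t]
      by (simp add: real log_slope_simps powr_minus divide_simps add.commute)
    finally have slope: "t powr (r - 1) / (t powr r + 1) = log_slope p t / t" .
    have "((\<lambda>t. (1 / r) * (ln (t powr r + 1) - ln 2)) has_real_derivative
        (1 / r) * (r * t powr (r - 1) / (t powr r + 1))) (at t)"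
      using \<open>t > 0\<close> pos[of t] by (auto intro!: derivative_eq_intros)
    moreover have "ln (pmean p s 1) = (1 / r) * (ln (s powr r + 1) - ln 2)" for s
      using False pos[of s] by (simp add: real pmean_simps ln_powr ln_div)
    ultimately show ?thesis
      using False slope by simp
  qed
  then show ?thesis
    by (rule DERIV_subset) simp
next
  case PInf
  have "((\<lambda>t. ln t) has_real_derivative log_slope p t / t) (at t within {1..})"
    using assms by (auto intro!: derivative_eq_intros simp: PInf log_slope_simps)
  then show ?thesis
    by (rule has_field_derivative_transform_within[of _ _ _ _ 1])
      (use assms in \<open>auto simp: PInf pmean_simps\<close>)
next
  case MInf
  have "((\<lambda>t. 0) has_real_derivative log_slope p t / t) (at t within {1..})"
    by (auto simp: MInf log_slope_simps)
  then show ?thesis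
    by (rule has_field_derivative_transform_within[of _ _ _ _ 1])
      (use assms in \<open>auto simp: MInf pmean_simps\<close>)
qed

text \<open>The logarithm of the quotient has derivative \<open>(log_slope p t - log_slope q t) / t \<ge> 0\<close>.\<close>

lemma pmean_quotient_mono:
  assumes "q \<le> p" "1 \<le> t" "t \<le> R"
  shows "pmean p t 1 / pmean q t 1 \<le> pmean p R 1 / pmean q R 1"
proof -
  let ?f = "\<lambda>t. ln (pmean p t 1) - ln (pmean q t 1)"
  have der: "(?f has_real_derivative (log_slope p u / u - log_slope q u / u)) (at u within {1..})"
    if "u \<ge> 1" for u
    using that by (intro derivative_intros ln_pmean_has_derivative)
  have "?f t \<le> ?f R"
  proof (rule DERIV_nonneg_imp_increasing_open[OF assms(3)])
    fix u assume u: "t < u" "u < R"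
    then have "(?f has_real_derivative (log_slope p u / u - log_slope q u / u)) (at u)"
      using der[of u] assms(2) at_within_interior[of u "{1..}"] by simp
    moreover have "log_slope p u / u - log_slope q u / u \<ge> 0"
      using u assms log_slope_mono[of q p u] by (simp add: divide_right_mono)
    ultimately show "\<exists>y. (?f has_real_derivative y) (at u) \<and> y \<ge> 0"
      by blast
  next
    have "continuous_on {1..} ?f"
      using der by (intro DERIV_continuous_on) auto
    then show "continuous_on {t..R} ?f"
      by (rule continuous_on_subset) (use assms in auto)
  qed
  moreover have pos: "pmean r t 1 > 0" "pmean r R 1 > 0" for r
    using assms by (auto intro: pmean_pos)
  ultimately have "ln (pmean p t 1 / pmean q t 1) \<le> ln (pmean p R 1 / pmean q R 1)"
    by (simp add: ln_div less_imp_neq[OF pos(1), symmetric] less_imp_neq[OF pos(2), symmetric])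
  then show ?thesis
    using pos by simp
qed

text \<open>By homogeneity and symmetry, only the ratio \<open>t \<ge> 1\<close> of the larger to the smaller argument
  counts, and the two hypotheses on \<open>R\<close> say that \<open>t \<le> R\<close>.\<close>

lemma pmean_le_quotient_mult:
  assumes "q \<le> p" "x > 0" "y > 0" "x \<le> R * y" "y \<le> R * x"
  shows "pmean p x y \<le> pmean p R 1 / pmean q R 1 * pmean q x y"
proof -
  have *: "pmean p x y \<le> pmean p R 1 / pmean q R 1 * pmean q x y"
    if "y \<le> x" "y > 0" "x \<le> R * y" for x y
  proof -
    have hom: "pmean r x y = y * pmean r (x / y) 1" for r
      using that pmean_mult[of y "x / y" 1 r] by simp
    have "pmean p (x / y) 1 / pmean q (x / y) 1 \<le> pmean p R 1 / pmean q R 1"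
      using that by (intro pmean_quotient_mono assms) (auto simp: field_simps)
    moreover have "pmean q (x / y) 1 > 0"
      using that by (intro pmean_pos) auto
    ultimately have "pmean p (x / y) 1 \<le> pmean p R 1 / pmean q R 1 * pmean q (x / y) 1"
      by (simp add: pos_divide_le_eq)
    from mult_left_mono[OF this, of y] that show ?thesis
      by (simp add: hom mult_ac)
  qed
  show ?thesis
    using *[of x y] *[of y x] assms by (cases "y \<le> x") (auto simp: pmean_commute[of _ y x])
qed

section \<open>Support and gauge functions of convex bodies\<close>

context
  fixes C :: "(real ^ 'n) set"
  assumes C: "C \<in> convex_bodies0"
begin

lemma inner_le_support_fun:
  assumes "x \<in> C"
  shows "a \<bullet> x \<le> support_fun C a"
proof -
  have "compact ((\<bullet>) a ` C)"
    using C by (intro compact_continuous_image continuous_intros) (auto simp: convex_bodies0_def)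
  then have "bdd_above ((\<bullet>) a ` C)"
    by (simp add: bounded_imp_bdd_above compact_imp_bounded)
  then show ?thesis
    unfolding support_fun_def using assms by (rule cSUP_upper2) auto
qed

lemma zero_in_body: "0 \<in> C"
  using C interior_subset by (auto simp: convex_bodies0_def)

lemma support_fun_attained:
  obtains x where "x \<in> C" "a \<bullet> x = support_fun C a"
proof -
  have "\<exists>x\<in>C. \<forall>y\<in>C. a \<bullet> y \<le> a \<bullet> x"
    using C zero_in_body
    by (intro continuous_attains_sup continuous_intros) (auto simp: convex_bodies0_def)
  then obtain x where x: "x \<in> C" "\<And>y. y \<in> C \<Longrightarrow> a \<bullet> y \<le> a \<bullet> x"
    by blast
  then have "support_fun C a \<le> a \<bullet> x"
    unfolding support_fun_def by (intro cSUP_least) auto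
  with inner_le_support_fun[OF x(1), of a] x(1) that show ?thesis
    by force
qed

lemma contains_cball:
  obtains r where "r > 0" "cball 0 r \<subseteq> C"
  using C by (auto simp: convex_bodies0_def mem_interior_cball)

lemma norm_bound:
  obtains B where "B > 0" "\<And>x. x \<in> C \<Longrightarrow> norm x \<le> B"
  using C by (auto simp: convex_bodies0_def bounded_pos dest!: compact_imp_bounded)

lemma support_fun_pos:
  assumes "a \<noteq> 0"
  shows "support_fun C a > 0"
proof -
  obtain r where r: "r > 0" "cball 0 r \<subseteq> C"
    by (rule contains_cball)
  have "(r / norm a) *\<^sub>R a \<in> C"
    using r assms by (intro subsetD[OF r(2)]) simp
  then have "a \<bullet> ((r / norm a) *\<^sub>R a) \<le> support_fun C a"
    by (rule inner_le_support_fun)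
  moreover have "a \<bullet> ((r / norm a) *\<^sub>R a) > 0"
    using r(1) assms by simp
  ultimately show ?thesis
    by linarith
qed

lemma continuous_on_support_fun: "continuous_on S (support_fun C)"
proof -
  obtain B where B: "B > 0" "\<And>x. x \<in> C \<Longrightarrow> norm x \<le> B"
    using norm_bound by blast
  have le: "support_fun C a - support_fun C b \<le> B * dist a b" for a b
  proof -
    obtain x where x: "x \<in> C" "a \<bullet> x = support_fun C a"
      by (rule support_fun_attained)
    have "support_fun C a = b \<bullet> x + (a - b) \<bullet> x"
      by (simp add: x(2) inner_diff_left)
    also have "\<dots> \<le> support_fun C b + norm (a - b) * B"
      using inner_le_support_fun[OF x(1)] norm_cauchy_schwarz[of "a - b" x]
        mult_left_mono[OF B(2)[OF x(1)], of "norm (a - b)"]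
      by (intro add_mono) auto
    finally show ?thesis
      by (simp add: dist_norm mult.commute)
  qed
  have "dist (support_fun C a) (support_fun C b) \<le> B * dist a b" for a b
    using le[of a b] le[of b a] by (simp add: dist_real_def abs_le_iff dist_commute)
  then have "B-lipschitz_on S (support_fun C)"
    using B(1) by (intro lipschitz_onI) auto
  then show ?thesis
    by (rule lipschitz_on_continuous_on)
qed

text \<open>A point outside \<open>l C\<close> is cut off by a hyperplane, whose normal can be taken to have norm 1.\<close>

lemma in_scaled_body_iff:
  assumes "l > 0"
  shows "x \<in> (*\<^sub>R) l ` C \<longleftrightarrow> (\<forall>a\<in>sphere 0 1. a \<bullet> x \<le> l * support_fun C a)"
proof
  assume "x \<in> (*\<^sub>R) l ` C"
  then show "\<forall>a\<in>sphere 0 1. a \<bullet> x \<le> l * support_fun C a"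
    using assms inner_le_support_fun by auto
next
  assume R: "\<forall>a\<in>sphere 0 1. a \<bullet> x \<le> l * support_fun C a"
  show "x \<in> (*\<^sub>R) l ` C"
  proof (rule ccontr)
    assume "x \<notin> (*\<^sub>R) l ` C"
    then have "(1 / l) *\<^sub>R x \<notin> C"
      using assms by (auto simp: image_iff)
    moreover have "convex C" "closed C"
      using C by (auto simp: convex_bodies0_def compact_imp_closed)
    ultimately obtain a b where ab: "a \<bullet> ((1 / l) *\<^sub>R x) < b" "\<And>y. y \<in> C \<Longrightarrow> a \<bullet> y > b"
      using separating_hyperplane_closed_point[of C "(1 / l) *\<^sub>R x"] by metis
    have "a \<noteq> 0"
      using ab(1) ab(2)[OF zero_in_body] by auto
    \<comment> \<open>The hyperplane has \<open>C\<close> on its upper side, so the outer normal of \<open>C\<close> is \<open>- a\<close>.\<close>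
    define u where "u = - (1 / norm a) *\<^sub>R a"
    have u: "u \<in> sphere 0 1"
      using \<open>a \<noteq> 0\<close> by (simp add: u_def)
    obtain y where y: "y \<in> C" "u \<bullet> y = support_fun C u"
      by (rule support_fun_attained)
    have inner_u: "u \<bullet> w = - ((a \<bullet> w) / norm a)" for w
      by (simp add: u_def)
    have "(a \<bullet> ((1 / l) *\<^sub>R x)) / norm a < (a \<bullet> y) / norm a"
      using less_trans[OF ab(1) ab(2)[OF y(1)]] \<open>a \<noteq> 0\<close> by (intro divide_strict_right_mono) auto
    then have "u \<bullet> y < u \<bullet> ((1 / l) *\<^sub>R x)"
      unfolding inner_u by linarith
    then have "support_fun C u < u \<bullet> ((1 / l) *\<^sub>R x)"
      by (simp only: y(2))
    then have "l * support_fun C u < u \<bullet> x"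
      using assms by (simp add: field_simps)
    with R u show False
      by force
  qed
qed

text \<open>For nonzero \<open>v\<close>, the reciprocal of the gauge is the radial function: the largest \<open>t\<close> with
  \<open>t *\<^sub>R v \<in> C\<close>.\<close>

lemma
  assumes "v \<noteq> 0"
  shows radial_pos: "inverse (gauge_fun C v) > 0"
    and radial_point_in_body: "inverse (gauge_fun C v) *\<^sub>R v \<in> C"
    and le_radial: "t > 0 \<Longrightarrow> t *\<^sub>R v \<in> C \<Longrightarrow> t \<le> inverse (gauge_fun C v)"
proof -
  obtain r where r: "r > 0" "cball 0 r \<subseteq> C"
    by (rule contains_cball)
  obtain B where B: "B > 0" "\<And>x. x \<in> C \<Longrightarrow> norm x \<le> B"
    using norm_bound by blast
  let ?A = "{l. l \<ge> 0 \<and> v \<in> (*\<^sub>R) l ` C}"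
  let ?b = "norm v / B"
  have b: "?b > 0"
    using assms B by simp
  \<comment> \<open>Every admissible \<open>l\<close> is at least \<open>?b > 0\<close>; away from zero, \<open>inverse\<close> is continuous, which
    makes the set of admissible \<open>l\<close> closed and its infimum attained.\<close>
  have A_eq: "?A = {?b..} \<inter> (\<lambda>l. inverse l *\<^sub>R v) -` C"
  proof (intro set_eqI iffI)
    fix l assume "l \<in> ?A"
    then obtain y where y: "y \<in> C" "v = l *\<^sub>R y" "l \<ge> 0"
      by blast
    then have "l > 0"
      using assms by (cases "l = 0") auto
    have "norm v \<le> l * B"
      using y B(2)[OF y(1)] by (simp add: mult_left_mono)
    then show "l \<in> {?b..} \<inter> (\<lambda>l. inverse l *\<^sub>R v) -` C"
      using y B(1) \<open>l > 0\<close> by (simp add: field_simps)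
  next
    fix l assume l: "l \<in> {?b..} \<inter> (\<lambda>l. inverse l *\<^sub>R v) -` C"
    then have "l > 0"
      using b by (meson IntD1 atLeast_iff less_le_trans)
    then show "l \<in> ?A"
      using l by (auto intro!: image_eqI[of _ _ "inverse l *\<^sub>R v"])
  qed
  have "closed ?A"
    unfolding A_eq using C b
    by (intro continuous_closed_preimage continuous_intros)
      (auto simp: convex_bodies0_def compact_imp_closed)
  moreover have "norm v / r \<in> ?A"
    using r assms
    by (auto intro!: image_eqI[of _ _ "(r / norm v) *\<^sub>R v"] subsetD[OF r(2)])
  moreover have bdd: "bdd_below ?A"
    by (rule bdd_belowI[of _ 0]) auto
  ultimately have "Inf ?A \<in> ?A"
    by (intro closed_contains_Inf) auto
  then have g: "gauge_fun C v \<in> {?b..} \<inter> (\<lambda>l. inverse l *\<^sub>R v) -` C"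
    unfolding gauge_fun_def A_eq[symmetric] by simp
  then have pos: "gauge_fun C v > 0"
    using b by (meson IntD1 atLeast_iff less_le_trans)
  show "inverse (gauge_fun C v) > 0"
    using pos by simp
  show "inverse (gauge_fun C v) *\<^sub>R v \<in> C"
    using g by simp
  show "t \<le> inverse (gauge_fun C v)" if "t > 0" "t *\<^sub>R v \<in> C"
  proof -
    have "inverse t \<in> ?A"
      using that by (auto intro!: image_eqI[of _ _ "t *\<^sub>R v"])
    then have "gauge_fun C v \<le> inverse t"
      unfolding gauge_fun_def by (intro cInf_lower bdd)
    then have "inverse (inverse t) \<le> inverse (gauge_fun C v)"
      using pos by (rule le_imp_inverse_le)
    then show ?thesis
      by simp
  qed
qed

end

section \<open>Covering radii and common touching directions\<close>

text \<open>The covering radius is the maximum of \<open>support_fun K / support_fun L\<close> over the sphere: a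
  direction in which the maximum is attained is one in which \<open>K\<close> and the scaled copy of \<open>L\<close>
  that covers it have the same supporting hyperplane.\<close>

lemma covering_radius_touching:
  fixes K L :: "(real ^ 'n) set"
  assumes K: "K \<in> convex_bodies0" and L: "L \<in> convex_bodies0"
  obtains a where "a \<in> sphere 0 1" "support_fun K a = covering_radius K L * support_fun L a"
    "covering_radius K L > 0" "K \<subseteq> (*\<^sub>R) (covering_radius K L) ` L"
proof -
  have pos: "support_fun K b > 0" "support_fun L b > 0" if "b \<in> sphere 0 1" for b
    using that K L by (auto intro!: support_fun_pos)
  have nz: "support_fun L b \<noteq> 0" if "b \<in> sphere 0 1" for b
    using pos(2)[OF that] by simp
  have "\<exists>a\<in>sphere 0 1. \<forall>b\<in>sphere 0 1.
      support_fun K b / support_fun L b \<le> support_fun K a / support_fun L (a :: real ^ 'n)"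
    using nz by (intro continuous_attains_sup continuous_intros continuous_on_support_fun K L) auto
  then obtain a :: "real ^ 'n" where a: "a \<in> sphere 0 1"
    and max: "\<And>b. b \<in> sphere 0 1 \<Longrightarrow>
      support_fun K b / support_fun L b \<le> support_fun K a / support_fun L a"
    by blast
  define R where "R = support_fun K a / support_fun L a"
  have "R > 0"
    using pos a by (simp add: R_def)
  have sub: "K \<subseteq> (*\<^sub>R) R ` L"
  proof
    fix x assume x: "x \<in> K"
    have "b \<bullet> x \<le> R * support_fun L b" if "b \<in> sphere 0 1" for b
    proof -
      have "b \<bullet> x \<le> support_fun K b"
        by (rule inner_le_support_fun[OF K x])
      also have "\<dots> \<le> R * support_fun L b"
        using max[OF that] pos[OF that] by (simp add: R_def pos_divide_le_eq)
      finally show ?thesis .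
    qed
    then show "x \<in> (*\<^sub>R) R ` L"
      using in_scaled_body_iff[OF L \<open>R > 0\<close>] by blast
  qed
  have least: "R \<le> l" if l: "l \<ge> 0" "K \<subseteq> (*\<^sub>R) l ` L" for l
  proof -
    obtain x where x: "x \<in> K" "a \<bullet> x = support_fun K a"
      by (rule support_fun_attained[OF K])
    then obtain y where y: "y \<in> L" "x = l *\<^sub>R y"
      using l(2) by blast
    have "support_fun K a = l * (a \<bullet> y)"
      using x y by simp
    also have "\<dots> \<le> l * support_fun L a"
      by (intro mult_left_mono inner_le_support_fun[OF L] y l)
    finally show ?thesis
      using pos[OF a] by (simp add: R_def pos_divide_le_eq)
  qed
  have R: "covering_radius K L = R"
    unfolding covering_radius_def
    by (rule cInf_eq_minimum) (use sub least \<open>R > 0\<close> in auto)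
  have touch: "support_fun K a = R * support_fun L a"
    using pos[OF a] by (simp add: R_def)
  show ?thesis
    by (rule that[OF a, unfolded R, OF touch \<open>R > 0\<close> sub])
qed

lemma support_fun_le_covering_radius_mult:
  assumes K: "K \<in> convex_bodies0" and L: "L \<in> convex_bodies0"
  shows "support_fun K a \<le> covering_radius K L * support_fun L a"
proof -
  let ?R = "covering_radius K L"
  obtain R: "?R > 0" "K \<subseteq> (*\<^sub>R) ?R ` L"
    by (rule covering_radius_touching[OF K L])
  obtain x where x: "x \<in> K" "a \<bullet> x = support_fun K a"
    by (rule support_fun_attained[OF K])
  then obtain y where y: "y \<in> L" "x = ?R *\<^sub>R y"
    using R by blast
  have "support_fun K a = ?R * (a \<bullet> y)"
    using x y by simp
  also have "\<dots> \<le> ?R * support_fun L a"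
    using R by (intro mult_left_mono inner_le_support_fun[OF L] y) simp
  finally show ?thesis .
qed

section \<open>Inclusions between means\<close>

lemma upper_pmean_commute: "upper_pmean p K L = upper_pmean p L K"
  by (simp add: upper_pmean_def pmean_commute)

lemma lower_pmean_commute: "lower_pmean p K L = lower_pmean p L K"
  by (simp add: lower_pmean_def pmean_commute)

lemma convex_upper_pmean: "convex (upper_pmean p K L)"
proof -
  have "upper_pmean p K L =
      (\<Inter>a\<in>sphere 0 1. {x. a \<bullet> x \<le> pmean p (support_fun K a) (support_fun L a)})"
    by (auto simp: upper_pmean_def)
  then show ?thesis
    by (auto intro: convex_INT convex_halfspace_le)
qed

text \<open>The radial point of \<open>K\<close> on the ray of \<open>v\<close> lies below the supporting hyperplane of \<open>K\<close> with
  normal \<open>a\<close>, and likewise for \<open>L\<close>. If \<open>a \<bullet> v > 0\<close>, taking means of these two inequalities gives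
  the claim on generators, as \<open>pmean p\<close> is monotone and homogeneous; otherwise the left-hand side
  is not positive.\<close>

lemma lower_pmean_subset_upper_pmean:
  assumes K: "K \<in> convex_bodies0" and L: "L \<in> convex_bodies0"
  shows "lower_pmean p K L \<subseteq> upper_pmean p K L"
  unfolding lower_pmean_def
proof (rule hull_minimal)
  show "convex (upper_pmean p K L)"
    by (rule convex_upper_pmean)
  show "(\<lambda>v. pmean p (inverse (gauge_fun K v)) (inverse (gauge_fun L v)) *\<^sub>R v) ` sphere 0 1
      \<subseteq> upper_pmean p K L"
  proof (clarsimp simp: upper_pmean_def)
    fix v a :: "real ^ 'a" assume "norm v = 1" "norm a = 1"
    then have nz: "v \<noteq> 0" "a \<noteq> 0"
      by auto
    let ?k = "inverse (gauge_fun K v)" and ?l = "inverse (gauge_fun L v)"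
    have kl: "?k > 0" "?l > 0"
      using radial_pos[OF K nz(1)] radial_pos[OF L nz(1)] by auto
    have h: "support_fun K a > 0" "support_fun L a > 0"
      using support_fun_pos[OF K nz(2)] support_fun_pos[OF L nz(2)] by auto
    have le: "?k * (a \<bullet> v) \<le> support_fun K a" "?l * (a \<bullet> v) \<le> support_fun L a"
      using inner_le_support_fun[OF K radial_point_in_body[OF K nz(1)], of a]
        inner_le_support_fun[OF L radial_point_in_body[OF L nz(1)], of a] by auto
    show "pmean p ?k ?l * (a \<bullet> v) \<le> pmean p (support_fun K a) (support_fun L a)"
    proof (cases "a \<bullet> v > 0")
      case True
      then have "pmean p ?k ?l * (a \<bullet> v) = pmean p (?k * (a \<bullet> v)) (?l * (a \<bullet> v))"
        using pmean_mult[OF True kl, of p] by (simp add: mult.commute)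
      also have "\<dots> \<le> pmean p (support_fun K a) (support_fun L a)"
        using True kl le by (intro pmean_mono mult_pos_pos)
      finally show ?thesis .
    next
      case False
      then have "pmean p ?k ?l * (a \<bullet> v) \<le> 0"
        using pmean_pos[OF kl, of p] by (intro mult_nonneg_nonpos) auto
      also have "\<dots> \<le> pmean p (support_fun K a) (support_fun L a)"
        using pmean_pos[OF h, of p] by simp
      finally show ?thesis .
    qed
  qed
qed

text \<open>The lower mean is convex and contains the origin, as opposite generators lie on opposite
  sides of it. So an inclusion in a multiple of it can be checked separately on every ray, against
  the generator on that ray.\<close>

lemma subset_scaled_lower_pmean:
  fixes K L :: "(real ^ 'n) set"
  assumes K: "K \<in> convex_bodies0" and L: "L \<in> convex_bodies0" and "c > 0"
    and ray: "\<And>v s. v \<in> sphere 0 1 \<Longrightarrow> s > 0 \<Longrightarrow> s *\<^sub>R v \<in> U \<Longrightarrow>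
      s \<le> c * pmean q (inverse (gauge_fun K v)) (inverse (gauge_fun L v))"
  shows "U \<subseteq> (*\<^sub>R) c ` lower_pmean q K L"
proof
  let ?M = "lower_pmean q K L"
  define m where "m v = pmean q (inverse (gauge_fun K v)) (inverse (gauge_fun L v))" for v
  have m_pos: "m v > 0" if "v \<noteq> 0" for v
    unfolding m_def using that by (intro pmean_pos radial_pos K L)
  have gen: "m v *\<^sub>R v \<in> ?M" if "norm v = 1" for v
    unfolding lower_pmean_def m_def using that by (intro hull_inc) auto
  have "convex ?M"
    by (simp add: lower_pmean_def)
  obtain e :: "real ^ 'n" where e: "norm e = 1"
    by (metis vector_choose_size zero_le_one)
  have me: "m e > 0" "m (- e) > 0"
    using e by (auto intro!: m_pos)
  \<comment> \<open>The weights that balance the generators on the rays of \<open>e\<close> and \<open>- e\<close>.\<close>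
  have "(m (- e) / (m e + m (- e))) *\<^sub>R (m e *\<^sub>R e)
      + (m e / (m e + m (- e))) *\<^sub>R (m (- e) *\<^sub>R (- e)) \<in> ?M"
    using e me gen[of e] gen[of "- e"]
    by (intro convexD[OF \<open>convex ?M\<close>]) (auto simp: add_divide_distrib[symmetric] add.commute)
  then have zero: "0 \<in> ?M"
    by (simp add: mult.commute)
  fix x assume x: "x \<in> U"
  show "x \<in> (*\<^sub>R) c ` ?M"
  proof (cases "x = 0")
    case True
    with zero show ?thesis
      by (auto intro!: image_eqI[of _ _ 0])
  next
    case False
    define v where "v = (1 / norm x) *\<^sub>R x"
    have v: "norm v = 1" "x = norm x *\<^sub>R v"
      using False by (simp_all add: v_def)
    have "norm x \<le> c * m v"
      unfolding m_def using v x False by (intro ray) auto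
    moreover have "m v > 0"
      using v(1) by (intro m_pos) auto
    ultimately have "(norm x / (c * m v)) *\<^sub>R (m v *\<^sub>R v) + (1 - norm x / (c * m v)) *\<^sub>R 0 \<in> ?M"
      using \<open>c > 0\<close> by (intro convexD[OF \<open>convex ?M\<close>] gen v zero) auto
    moreover have "x = c *\<^sub>R ((norm x / (c * m v)) *\<^sub>R (m v *\<^sub>R v))"
      using \<open>m v > 0\<close> \<open>c > 0\<close> v(2) by simp
    ultimately show ?thesis
      by (metis image_eqI add.right_neutral scaleR_zero_right)
  qed
qed

text \<open>An infimum over the empty set would make the covering radius of the means meaningless; this
  inclusion shows that some factor is always admissible. Balls inside and around the bodies give
  one.\<close>

lemma upper_pmean_subset_some_scaled_lower_pmean:
  fixes K L :: "(real ^ 'n) set"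
  assumes K: "K \<in> convex_bodies0" and L: "L \<in> convex_bodies0"
  obtains c where "c > 0" "upper_pmean p K L \<subseteq> (*\<^sub>R) c ` lower_pmean q K L"
proof -
  obtain B1 B2 where B: "B1 > 0" "\<And>x. x \<in> K \<Longrightarrow> norm x \<le> B1" "B2 > 0" "\<And>x. x \<in> L \<Longrightarrow> norm x \<le> B2"
    using norm_bound[OF K] norm_bound[OF L] by metis
  obtain r1 r2 where r: "r1 > 0" "cball 0 r1 \<subseteq> K" "r2 > 0" "cball 0 r2 \<subseteq> L"
    using contains_cball[OF K] contains_cball[OF L] by metis
  have sup: "support_fun K v \<le> B1" "support_fun L v \<le> B2" if "norm v = 1" for v
    unfolding support_fun_def
    using zero_in_body[OF K] zero_in_body[OF L] B that
    by (auto intro!: cSUP_least order.trans[OF norm_cauchy_schwarz])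
  have "upper_pmean p K L \<subseteq> (*\<^sub>R) (pmean p B1 B2 / pmean q r1 r2) ` lower_pmean q K L"
  proof (rule subset_scaled_lower_pmean[OF K L])
    show "pmean p B1 B2 / pmean q r1 r2 > 0"
      using B r by (intro divide_pos_pos pmean_pos)
    fix v :: "real ^ 'n" and s assume v: "v \<in> sphere 0 1" and s: "s > 0" "s *\<^sub>R v \<in> upper_pmean p K L"
    then have [simp]: "v \<noteq> 0" "norm v = 1" "v \<bullet> v = 1"
      by (auto simp: norm_eq_1)
    have "s = v \<bullet> (s *\<^sub>R v)"
      by simp
    also have "\<dots> \<le> pmean p (support_fun K v) (support_fun L v)"
      using s(2) v unfolding upper_pmean_def by blast
    also have "\<dots> \<le> pmean p B1 B2"
      by (intro pmean_mono sup support_fun_pos K L) auto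
    finally have "s \<le> pmean p B1 B2" .
    moreover have "r1 \<le> inverse (gauge_fun K v)" "r2 \<le> inverse (gauge_fun L v)"
      using r by (auto intro!: le_radial K L)
    then have "pmean q r1 r2 \<le> pmean q (inverse (gauge_fun K v)) (inverse (gauge_fun L v))"
      using r by (intro pmean_mono)
    ultimately have "s * pmean q r1 r2 \<le>
        pmean p B1 B2 * pmean q (inverse (gauge_fun K v)) (inverse (gauge_fun L v))"
      using s B r by (intro mult_mono) (auto intro: less_imp_le pmean_pos)
    then show "s \<le> pmean p B1 B2 / pmean q r1 r2
        * pmean q (inverse (gauge_fun K v)) (inverse (gauge_fun L v))"
      using pmean_pos[OF r(1,3), of q] by (simp add: field_simps)
  qed
  then show ?thesis
    using that B r by (metis divide_pos_pos pmean_pos)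
qed

section \<open>The lower bound\<close>

text \<open>At a touching direction \<open>a\<close>, the point \<open>x\<close> of \<open>K\<close> farthest in direction \<open>a\<close> generates a
  point of the lower \<open>p\<close>-mean at height at least \<open>pmean p R 1 * support_fun L a\<close>, while the
  upper \<open>q\<close>-mean stays below \<open>pmean q R 1 * support_fun L a\<close>.\<close>

lemma pmean_quotient_le_of_lower_subset_scaled_upper:
  assumes K: "K \<in> convex_bodies0" and L: "L \<in> convex_bodies0" and "l \<ge> 0"
    and sub: "lower_pmean p K L \<subseteq> (*\<^sub>R) l ` upper_pmean q K L"
  shows "pmean p (covering_radius K L) 1 / pmean q (covering_radius K L) 1 \<le> l"
proof -
  define R where "R = covering_radius K L"
  obtain a where a: "a \<in> sphere 0 1" "support_fun K a = R * support_fun L a"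
    and R: "R > 0" "K \<subseteq> (*\<^sub>R) R ` L"
    unfolding R_def by (rule covering_radius_touching[OF K L])
  define h where "h = support_fun L a"
  have "h > 0"
    unfolding h_def using a by (intro support_fun_pos L) auto
  obtain x where x: "x \<in> K" "a \<bullet> x = R * h"
    using support_fun_attained[OF K, of a] a(2) unfolding h_def by metis
  have "x \<noteq> 0"
    using x R \<open>h > 0\<close> by auto
  define n where "n = norm x"
  have "n > 0"
    using \<open>x \<noteq> 0\<close> by (simp add: n_def)
  define v where "v = (1 / n) *\<^sub>R x"
  have v: "norm v = 1" "x = n *\<^sub>R v" "v \<noteq> 0"
    using \<open>x \<noteq> 0\<close> by (simp_all add: v_def n_def)
  obtain y where y: "y \<in> L" "x = R *\<^sub>R y"
    using x R by blast
  have "y = (1 / R) *\<^sub>R x"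
    using y(2) R(1) by simp
  then have "y = (n / R) *\<^sub>R v"
    by (simp add: v(2))
  then have "n / R \<le> inverse (gauge_fun L v)"
    using y R \<open>n > 0\<close> by (intro le_radial L v) auto
  moreover have "n \<le> inverse (gauge_fun K v)"
    using x v \<open>n > 0\<close> by (intro le_radial K) auto
  ultimately have "pmean p n (n / R) \<le> pmean p (inverse (gauge_fun K v)) (inverse (gauge_fun L v))"
    (is "_ \<le> ?m")
    using R \<open>n > 0\<close> by (intro pmean_mono) auto
  moreover have "pmean p n (n / R) = n / R * pmean p R 1"
    using pmean_mult[of "n / R" R 1 p] R \<open>n > 0\<close> by simp
  ultimately have m: "n / R * pmean p R 1 \<le> ?m"
    by simp
  have av: "a \<bullet> v = R * h / n"
    using x(2) by (simp add: v_def)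
  \<comment> \<open>Both sides are heights in direction \<open>a\<close>; on the left, \<open>n\<close> and one factor \<open>R\<close> cancel.\<close>
  have "n / R * pmean p R 1 * (R * h / n) \<le> ?m * (R * h / n)"
    using R \<open>h > 0\<close> \<open>n > 0\<close> by (intro mult_right_mono m) auto
  then have above: "pmean p R 1 * h \<le> a \<bullet> (?m *\<^sub>R v)"
    using R \<open>n > 0\<close> by (simp add: av)
  have "?m *\<^sub>R v \<in> lower_pmean p K L"
    unfolding lower_pmean_def using v by (intro hull_inc) auto
  then obtain z where z: "z \<in> upper_pmean q K L" "?m *\<^sub>R v = l *\<^sub>R z"
    using sub by blast
  have "a \<bullet> z \<le> pmean q (support_fun K a) (support_fun L a)"
    using z(1) a(1) by (auto simp: upper_pmean_def)
  also have "\<dots> = h * pmean q R 1"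
    using pmean_mult[OF \<open>h > 0\<close> \<open>R > 0\<close>, of 1 q] a(2) by (simp add: h_def mult.commute)
  finally have "l * (a \<bullet> z) \<le> l * (h * pmean q R 1)"
    using \<open>l \<ge> 0\<close> by (rule mult_left_mono)
  then have "h * pmean p R 1 \<le> h * (l * pmean q R 1)"
    using above unfolding z(2) by (simp add: mult_ac)
  then have "pmean p R 1 \<le> l * pmean q R 1"
    using \<open>h > 0\<close> by simp
  then show ?thesis
    using pmean_pos[OF R(1), of 1 q] by (simp add: R_def pos_divide_le_eq)
qed

section \<open>The cases of equality\<close>

text \<open>On the line, the radial function and the support function agree on unit vectors, so the test
  on a ray compares the \<open>p\<close>-mean and the \<open>q\<close>-mean of the same two numbers, and
  \<open>pmean_le_quotient_mult\<close> applies. The order \<open>q \<le> p\<close> matters because the ratio of the larger to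
  the smaller support value is \<open>R\<close> at one end of the segments but may be less at the other.\<close>

lemma upper_subset_scaled_lower_dim_one:
  fixes K L :: "(real ^ 'n) set"
  assumes K: "K \<in> convex_bodies0" and L: "L \<in> convex_bodies0"
    and dim: "CARD('n) = 1" and "q \<le> p"
  defines "R \<equiv> covering_dist K L"
  shows "upper_pmean p K L \<subseteq> (*\<^sub>R) (pmean p R 1 / pmean q R 1) ` lower_pmean q K L"
proof (rule subset_scaled_lower_pmean[OF K L])
  have "covering_radius K L > 0"
    by (rule covering_radius_touching[OF K L])
  then have "R > 0"
    by (simp add: R_def covering_dist_def)
  then show quot: "pmean p R 1 / pmean q R 1 > 0"
    by (intro divide_pos_pos pmean_pos) auto
  fix v :: "real ^ 'n" and s assume v: "v \<in> sphere 0 1" and s: "s > 0" "s *\<^sub>R v \<in> upper_pmean p K L"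
  then have [simp]: "v \<noteq> 0" "v \<bullet> v = 1"
    by (auto simp: norm_eq_1)
  have line: "x = (v \<bullet> x) *\<^sub>R v" for x
  proof -
    obtain i :: 'n where i: "UNIV = {i}"
      using dim card_1_singletonE by blast
    have vv: "v $ i * v $ i = 1"
      using \<open>v \<bullet> v = 1\<close> by (simp add: inner_vec_def i)
    have "((v \<bullet> x) *\<^sub>R v) $ i = (v $ i * v $ i) * x $ i"
      by (simp add: inner_vec_def i)
    moreover have "j = i" for j
      using i by auto
    ultimately show ?thesis
      unfolding vv by (metis mult_1 vec_eq_iff)
  qed
  have pos: "support_fun K v > 0" "support_fun L v > 0"
    by (auto intro!: support_fun_pos K L)
  \<comment> \<open>A farthest point of \<open>C\<close> in direction \<open>v\<close> lies on the ray of \<open>v\<close>.\<close>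
  have radial: "support_fun C v \<le> inverse (gauge_fun C v)" if C: "C \<in> convex_bodies0" for C
  proof -
    obtain x where "x \<in> C" "v \<bullet> x = support_fun C v"
      by (rule support_fun_attained[OF C])
    then have "support_fun C v *\<^sub>R v \<in> C"
      using line[of x] by simp
    then show ?thesis
      by (intro le_radial C support_fun_pos) auto
  qed
  have mq: "pmean q (support_fun K v) (support_fun L v)
      \<le> pmean q (inverse (gauge_fun K v)) (inverse (gauge_fun L v))"
    by (intro pmean_mono pos radial K L)
  have le: "support_fun K v \<le> R * support_fun L v" "support_fun L v \<le> R * support_fun K v"
    using support_fun_le_covering_radius_mult[OF K L, of v]
      support_fun_le_covering_radius_mult[OF L K, of v] pos
    by (auto simp: R_def covering_dist_def elim!: order.trans intro!: mult_right_mono)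
  have "s = v \<bullet> (s *\<^sub>R v)"
    by simp
  also have "\<dots> \<le> pmean p (support_fun K v) (support_fun L v)"
    using s(2) v unfolding upper_pmean_def by blast
  also have "\<dots> \<le> pmean p R 1 / pmean q R 1 * pmean q (support_fun K v) (support_fun L v)"
    by (intro pmean_le_quotient_mult pos le \<open>q \<le> p\<close>)
  also have "\<dots> \<le> pmean p R 1 / pmean q R 1
      * pmean q (inverse (gauge_fun K v)) (inverse (gauge_fun L v))"
    using quot by (intro mult_left_mono mq) simp
  finally show "s \<le> pmean p R 1 / pmean q R 1
      * pmean q (inverse (gauge_fun K v)) (inverse (gauge_fun L v))" .
qed

text \<open>If \<open>L = cK\<close>, then every upper or lower mean is a multiple of \<open>K\<close>, with factor
  \<open>pmean _ 1 c\<close>. The covering distance is \<open>c\<close> or \<open>1 / c\<close>, and homogeneity makes both give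
  the same quotient of means.\<close>

lemma upper_subset_scaled_lower_dilates:
  fixes K L :: "(real ^ 'n) set"
  assumes K: "K \<in> convex_bodies0" and L: "L \<in> convex_bodies0" and "dilates K L"
  defines "R \<equiv> covering_dist K L"
  shows "upper_pmean p K L \<subseteq> (*\<^sub>R) (pmean p R 1 / pmean q R 1) ` lower_pmean q K L"
proof -
  obtain c where c: "c > 0" "L = (*\<^sub>R) c ` K"
    using assms(3) by (auto simp: dilates_def)
  have hL: "support_fun L a = c * support_fun K a" for a
  proof (rule antisym)
    obtain x where x: "x \<in> L" "a \<bullet> x = support_fun L a"
      by (rule support_fun_attained[OF L])
    then obtain y where "y \<in> K" "x = c *\<^sub>R y"
      using c by blast
    then show "support_fun L a \<le> c * support_fun K a"
      using x(2) c(1) inner_le_support_fun[OF K, of y a] by (simp flip: x(2))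
    obtain y where y: "y \<in> K" "a \<bullet> y = support_fun K a"
      by (rule support_fun_attained[OF K])
    then have "a \<bullet> (c *\<^sub>R y) \<le> support_fun L a"
      using c by (intro inner_le_support_fun[OF L]) auto
    then show "c * support_fun K a \<le> support_fun L a"
      using y(2) by simp
  qed
  have hpos: "support_fun K a > 0" if "a \<in> sphere 0 1" for a
    using that by (intro support_fun_pos K) auto
  have "covering_radius K L = 1 / c"
  proof -
    obtain a where a: "a \<in> sphere 0 1" "support_fun K a = covering_radius K L * support_fun L a"
      by (rule covering_radius_touching[OF K L])
    then show ?thesis
      using hpos[OF a(1)] c(1) by (simp add: hL field_simps)
  qed
  moreover have "covering_radius L K = c"
  proof -
    obtain a where a: "a \<in> sphere 0 1" "support_fun L a = covering_radius L K * support_fun K a"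
      by (rule covering_radius_touching[OF L K])
    then show ?thesis
      using hpos[OF a(1)] by (simp add: hL)
  qed
  ultimately have "R = 1 / c \<or> R = c"
    by (auto simp: R_def covering_dist_def max_def)
  moreover have "pmean r (1 / c) 1 = pmean r 1 c / c" for r
    using pmean_mult[of "1 / c" 1 c r] c(1) by simp
  ultimately have quot: "pmean p R 1 / pmean q R 1 = pmean p 1 c / pmean q 1 c"
    using c(1) by (auto simp: pmean_commute[of _ c 1])
  have mpos: "pmean r 1 c > 0" for r
    using c(1) by (intro pmean_pos) auto
  show ?thesis
    unfolding quot
  proof (rule subset_scaled_lower_pmean[OF K L])
    show "pmean p 1 c / pmean q 1 c > 0"
      by (intro divide_pos_pos mpos)
    fix v :: "real ^ 'n" and s assume v: "v \<in> sphere 0 1" and s: "s > 0" "s *\<^sub>R v \<in> upper_pmean p K L"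
    then have "v \<noteq> 0"
      by auto
    define k where "k = inverse (gauge_fun K v)"
    have k: "k > 0" "k *\<^sub>R v \<in> K"
      using radial_pos[OF K \<open>v \<noteq> 0\<close>] radial_point_in_body[OF K \<open>v \<noteq> 0\<close>] by (simp_all add: k_def)
    have "pmean p (support_fun K a) (support_fun L a) = pmean p 1 c * support_fun K a"
      if "a \<in> sphere 0 1" for a
      using pmean_mult[OF hpos[OF that], of 1 c p] c(1) by (simp add: hL mult.commute)
    then have "s *\<^sub>R v \<in> (*\<^sub>R) (pmean p 1 c) ` K"
      using s(2) by (subst in_scaled_body_iff[OF K mpos]) (auto simp: upper_pmean_def)
    then obtain y where y: "y \<in> K" "s *\<^sub>R v = pmean p 1 c *\<^sub>R y"
      by blast
    have "(s / pmean p 1 c) *\<^sub>R v = (1 / pmean p 1 c) *\<^sub>R (s *\<^sub>R v)"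
      by simp
    also have "\<dots> = y"
      using mpos[of p] by (simp add: y(2))
    finally have "(s / pmean p 1 c) *\<^sub>R v \<in> K"
      using y(1) by simp
    then have "s / pmean p 1 c \<le> k"
      unfolding k_def using s(1) mpos by (intro le_radial[OF K \<open>v \<noteq> 0\<close>]) auto
    then have s_le: "s \<le> pmean p 1 c / pmean q 1 c * (k * pmean q 1 c)"
      using mpos[of p] mpos[of q] by (simp add: pos_divide_le_eq mult.commute)
    have "c * k \<le> inverse (gauge_fun L v)"
      using c k by (intro le_radial[OF L \<open>v \<noteq> 0\<close>]) (auto intro!: image_eqI[of _ _ "k *\<^sub>R v"])
    moreover have "k * pmean q 1 c = pmean q k (c * k)"
      using pmean_mult[OF k(1), of 1 c q] c(1) by (simp add: mult.commute)
    ultimately have "k * pmean q 1 c \<le> pmean q k (inverse (gauge_fun L v))"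
      using c k by (simp add: pmean_mono)
    then have "pmean p 1 c / pmean q 1 c * (k * pmean q 1 c)
        \<le> pmean p 1 c / pmean q 1 c * pmean q k (inverse (gauge_fun L v))"
      by (rule mult_left_mono) (use mpos in \<open>simp add: less_imp_le\<close>)
    with s_le show "s \<le> pmean p 1 c / pmean q 1 c
        * pmean q (inverse (gauge_fun K v)) (inverse (gauge_fun L v))"
      unfolding k_def by (rule order.trans)
  qed
qed

theorem theorem1p5:
  fixes K L :: "(real ^ 'n) set"
    and p q :: ereal
    and Mp Mq :: "(real ^ 'n) set \<Rightarrow> (real ^ 'n) set \<Rightarrow> (real ^ 'n) set"
  assumes "K \<in> convex_bodies0" and "L \<in> convex_bodies0"
    and "Mp \<in> {upper_pmean p, lower_pmean p}"
    and "Mq \<in> {upper_pmean q, lower_pmean q}"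
  shows "pmean p (covering_dist K L) 1 / pmean q (covering_dist K L) 1
           \<le> covering_radius (Mp K L) (Mq K L)
         \<and> ((CARD('n) = 1 \<and> q \<le> p) \<or> dilates K L \<longrightarrow>
             pmean p (covering_dist K L) 1 / pmean q (covering_dist K L) 1
               = covering_radius (Mp K L) (Mq K L))"
proof -
  note K = assms(1) and L = assms(2)
  define R where "R = covering_dist K L"
  define Q where "Q = pmean p R 1 / pmean q R 1"
  let ?S = "{l. l \<ge> 0 \<and> Mp K L \<subseteq> (*\<^sub>R) l ` Mq K L}"
  have Mp: "lower_pmean p K L \<subseteq> Mp K L" "Mp K L \<subseteq> upper_pmean p K L"
    and Mq: "lower_pmean q K L \<subseteq> Mq K L" "Mq K L \<subseteq> upper_pmean q K L"
    using assms(3,4) lower_pmean_subset_upper_pmean[OF K L] by auto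
  have mem: "l \<in> ?S" if "l \<ge> 0" "upper_pmean p K L \<subseteq> (*\<^sub>R) l ` lower_pmean q K L" for l
    using that Mp(2) image_mono[OF Mq(1), of "(*\<^sub>R) l"] by auto
  have lower: "Q \<le> l" if "l \<in> ?S" for l
  proof -
    have l: "l \<ge> 0" "lower_pmean p K L \<subseteq> (*\<^sub>R) l ` upper_pmean q K L"
      using that Mp(1) image_mono[OF Mq(2), of "(*\<^sub>R) l"] by blast+
    then have "lower_pmean p L K \<subseteq> (*\<^sub>R) l ` upper_pmean q L K"
      by (simp add: lower_pmean_commute[of p L] upper_pmean_commute[of q L])
    then show ?thesis
      using pmean_quotient_le_of_lower_subset_scaled_upper[OF K L l]
        pmean_quotient_le_of_lower_subset_scaled_upper[OF L K l(1)]
      by (auto simp: Q_def R_def covering_dist_def max_def)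
  qed
  obtain c where "c > 0" "upper_pmean p K L \<subseteq> (*\<^sub>R) c ` lower_pmean q K L"
    by (rule upper_pmean_subset_some_scaled_lower_pmean[OF K L])
  then have "?S \<noteq> {}"
    using mem[of c] by (metis empty_iff less_imp_le)
  then have "Q \<le> covering_radius (Mp K L) (Mq K L)"
    unfolding covering_radius_def by (rule cInf_greatest) (rule lower)
  moreover have "covering_radius (Mp K L) (Mq K L) = Q" if "(CARD('n) = 1 \<and> q \<le> p) \<or> dilates K L"
  proof -
    have "covering_radius K L > 0"
      by (rule covering_radius_touching[OF K L])
    then have "Q > 0"
      by (auto simp: Q_def R_def covering_dist_def intro!: divide_pos_pos pmean_pos)
    moreover have "upper_pmean p K L \<subseteq> (*\<^sub>R) Q ` lower_pmean q K L"
      using that upper_subset_scaled_lower_dim_one[OF K L] upper_subset_scaled_lower_dilates[OF K L]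
      unfolding Q_def R_def by blast
    ultimately have "Q \<in> ?S"
      by (intro mem) auto
    then show ?thesis
      unfolding covering_radius_def by (rule cInf_eq_minimum) (rule lower)
  qed
  ultimately show ?thesis
    unfolding Q_def R_def by auto
qed

end
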